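(* Let $N,M\ge 1$ be integers, $\Delta f,T_{\mathrm{sym}},\sigma_w^2,P_s>0$, and $\alpha\in\mathbb{C}\setminus\{0\}$ (all known). For $n\in\{-(N-1)/2,\ldots,(N-1)/2\}$ and $m\in\{-(M-1)/2,\ldots,(M-1)/2\}$ (unit steps) consider the observations $$\tilde y[n,m]=\alpha\,e^{-j2\pi n\Delta f\tau}\,e^{j2\pi mT_{\mathrm{sym}}f_d}+\tilde w[n,m],$$ where the $\tilde w[n,m]\sim\mathcal{CN}(0,\sigma_w^2/P_s)$ are independent and $(\tau,f_d)\in\mathbb{R}^2$ is the unknown parameter. Then the Fisher information matrix for $(\tau,f_d)$ from a single coherent processing interval (i.e. from all $NM$ observations) is $$\mathbf{J}(\tau,f_d)=2NM\gamma_{\mathrm{sc}}\begin{bmatrix}4\pi^2\beta_{\mathrm{rms}}^2&0\\0&4\pi^2\gamma_{\mathrm{rms}}^2\end{bmatrix},$$ where $\gamma_{\mathrm{sc}}=|\alpha|^2P_s/\sigma_w^2$ and $$\beta_{\mathrm{rms}}^2=\frac{N^2-1}{12}\,\Delta f^2\approx\frac{B^2}{12},\qquad \gamma_{\mathrm{rms}}^2=\frac{M^2-1}{12}\,T_{\mathrm{sym}}^2\approx\frac{T_{\mathrm{CPI}}^2}{12},$$ with $B=N\Delta f$ and $T_{\mathrm{CPI}}=MT_{\mathrm{sym}}$. In particular the off-diagonal terms vanish.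
   Context: Here $j^2=-1$ and $\mathcal{CN}(\mu,s^2)$ is the circularly symmetric complex Gaussian law with mean $\mu$ and variance $s^2$. The model is the echo of an OFDM waveform with $N$ subcarriers of spacing $\Delta f$ and $M$ symbols of duration $T_{\mathrm{sym}}$ from a point target with round-trip delay $\tau$ and two-way Doppler shift $f_d$, after element-wise division by the known transmitted data symbols of constant squared modulus $P_s$. The complex amplitude $\alpha$ is not treated as a nuisance parameter: only $(\tau,f_d)$ is unknown. The symbols "$\approx$" denote the approximations $N^2-1\approx N^2$ and $M^2-1\approx M^2$ for large $N,M$; the equalities define $\beta_{\mathrm{rms}}^2$ (squared RMS bandwidth) and $\gamma_{\mathrm{rms}}^2$ (squared RMS observation time). *)

theory Defs
  imports "HOL-Probability.Probability" "HOL-Library.Landau_Symbols"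
begin

text \<open>
  Density, with respect to Lebesgue measure on the complex plane, of the circularly symmetric
  complex Gaussian law with mean \<open>\<mu>\<close> and variance \<open>v\<close>. The variance is the complex one,
  the expectation of \<open>(cmod (z - \<mu>))\<^sup>2\<close>: real and imaginary parts have variance \<open>v / 2\<close> each.
\<close>
definition cn_density :: "complex \<Rightarrow> real \<Rightarrow> complex \<Rightarrow> real" where
  "cn_density \<mu> v z = exp (- (cmod (z - \<mu>))\<^sup>2 / v) / (pi * v)"

text \<open>
  Here \<open>p \<theta>\<close> is the density with respect to \<open>\<nu>\<close> of the observation under the parameter \<open>\<theta>\<close>.
  The values below are meaningful only where the partial derivatives and the integrals exist.
\<close>
definition score :: "(real ^ 'k \<Rightarrow> 'a \<Rightarrow> real) \<Rightarrow> real ^ 'k \<Rightarrow> 'a \<Rightarrow> real ^ 'k" where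
  "score p \<theta> x = (\<chi> i. deriv (\<lambda>h. ln (p (\<theta> + h *\<^sub>R axis i 1) x)) 0)"

definition fisher_information ::
  "'a measure \<Rightarrow> (real ^ 'k \<Rightarrow> 'a \<Rightarrow> real) \<Rightarrow> real ^ 'k \<Rightarrow> real ^ 'k ^ 'k" where
  "fisher_information \<nu> p \<theta> =
     (\<chi> i j. \<integral>x. score p \<theta> x $ i * score p \<theta> x $ j \<partial>density \<nu> (\<lambda>x. ennreal (p \<theta> x)))"

text \<open>The points \<open>-(N-1)/2, \<dots>, (N-1)/2\<close> in unit steps; they are half-integers when \<open>N\<close> is even.\<close>
definition centered_range :: "nat \<Rightarrow> real set" where
  "centered_range N = (\<lambda>i. real i - (real N - 1) / 2) ` {..<N}"

definition ofdm_grid :: "nat \<Rightarrow> nat \<Rightarrow> (real \<times> real) set" where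
  "ofdm_grid N M = centered_range N \<times> centered_range M"

text \<open>The parameter is \<open>\<theta> = (\<tau>, f\<^sub>d)\<close>: \<open>\<theta> $ 1\<close> is the delay and \<open>\<theta> $ 2\<close> the Doppler shift.\<close>
definition ofdm_echo ::
  "complex \<Rightarrow> real \<Rightarrow> real \<Rightarrow> real ^ 2 \<Rightarrow> real \<times> real \<Rightarrow> complex" where
  "ofdm_echo \<alpha> \<Delta>f Tsym \<theta> = (\<lambda>(n, m).
     \<alpha> * exp (- \<i> * complex_of_real (2 * pi * n * \<Delta>f * (\<theta> $ 1)))
       * exp (\<i> * complex_of_real (2 * pi * m * Tsym * (\<theta> $ 2))))"

abbreviation obs_base :: "nat \<Rightarrow> nat \<Rightarrow> (real \<times> real \<Rightarrow> complex) measure" where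
  "obs_base N M \<equiv> PiM (ofdm_grid N M) (\<lambda>_. lborel)"

definition ofdm_likelihood ::
  "nat \<Rightarrow> nat \<Rightarrow> complex \<Rightarrow> real \<Rightarrow> real \<Rightarrow> real \<Rightarrow>
     real ^ 2 \<Rightarrow> (real \<times> real \<Rightarrow> complex) \<Rightarrow> real" where
  "ofdm_likelihood N M \<alpha> \<Delta>f Tsym v \<theta> y =
     (\<Prod>k\<in>ofdm_grid N M. cn_density (ofdm_echo \<alpha> \<Delta>f Tsym \<theta> k) v (y k))"

definition beta_rms_sq :: "nat \<Rightarrow> real \<Rightarrow> real" where
  "beta_rms_sq N \<Delta>f = ((real N)\<^sup>2 - 1) / 12 * \<Delta>f\<^sup>2"

definition gamma_rms_sq :: "nat \<Rightarrow> real \<Rightarrow> real" where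
  "gamma_rms_sq M Tsym = ((real M)\<^sup>2 - 1) / 12 * Tsym\<^sup>2"

definition gamma_sc :: "complex \<Rightarrow> real \<Rightarrow> real \<Rightarrow> real" where
  "gamma_sc \<alpha> Ps \<sigma>w2 = (cmod \<alpha>)\<^sup>2 * Ps / \<sigma>w2"

end

theory Submission
  imports Defs "HOL-Real_Asymp.Real_Asymp"
begin

text \<open>
  The likelihood is the density of the law of the observations, so Fisher information integrals are
  expectations over the noise. The partial derivative of the echo \<open>s\<^sub>k\<close> in direction \<open>i\<close> is \<open>c\<^sub>k\<^sub>i\<close>
  times \<open>\<i> s\<^sub>k\<close> with a real rate \<open>c\<^sub>k\<^sub>i\<close> (\<open>-2\<pi> n \<Delta>f\<close> for the delay, \<open>2\<pi> m T\<^sub>s\<^sub>y\<^sub>m\<close> for the Doppler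
  shift). Evaluated at the observations, the score is therefore the real-linear form
  \<open>(2/v) \<Sum>\<^sub>k c\<^sub>k\<^sub>i (w\<^sub>k \<bullet> \<i> s\<^sub>k)\<close> in the independent circular noise \<open>w\<^sub>k\<close>, where \<open>v\<close> is the noise variance
  and the inner product is that of the real plane. Since \<open>w \<bullet> a\<close> and \<open>w \<bullet> b\<close> have
  covariance \<open>(v/2) (a \<bullet> b)\<close>, the information is \<open>(2/v) |\<alpha>|\<^sup>2 \<Sum>\<^sub>k c\<^sub>k\<^sub>i c\<^sub>k\<^sub>j\<close>, and the off-diagonal sum
  vanishes because the index ranges are centred at 0.
\<close>

section \<open>Product densities\<close>

text \<open>Lebesgue measure on the space is the image of a product of one-dimensional Lebesgue
  measures, so Fubini applies. This reduces plane integrals to line integrals.\<close>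

lemma
  fixes f :: "'a::euclidean_space \<Rightarrow> real \<Rightarrow> real"
  assumes f: "\<And>b. b \<in> Basis \<Longrightarrow> integrable lborel (f b)"
  shows integrable_lborel_prod: "integrable lborel (\<lambda>x. \<Prod>b\<in>Basis. f b (x \<bullet> b))"
    and integral_lborel_prod:
      "(\<integral>x. (\<Prod>b\<in>Basis. f b (x \<bullet> b)) \<partial>lborel) = (\<Prod>b\<in>Basis. \<integral>x. f b x \<partial>lborel)"
proof -
  interpret product_sigma_finite "\<lambda>_::'a. lborel :: real measure"
    by standard
  have [measurable]: "f b \<in> borel_measurable borel" if "b \<in> Basis" for b
    using borel_measurable_integrable[OF f[OF that]] by simp
  show "integrable lborel (\<lambda>x. \<Prod>b\<in>Basis. f b (x \<bullet> b))"
    by (subst lborel_eq) (simp add: integrable_distr_eq product_integrable_prod f)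
  show "(\<integral>x. (\<Prod>b\<in>Basis. f b (x \<bullet> b)) \<partial>lborel) = (\<Prod>b\<in>Basis. \<integral>x. f b x \<partial>lborel)"
    by (subst lborel_eq) (simp add: integral_distr product_integral_prod f)
qed

text \<open>With sigma-finite factors, the product measure is the only one giving each box the
  product of its side masses; Tonelli shows that the left side does so.\<close>

lemma density_PiM:
  assumes M: "\<And>i. sigma_finite_measure (M i)" and I: "finite I"
    and f[measurable]: "\<And>i. i \<in> I \<Longrightarrow> f i \<in> borel_measurable (M i)"
    and sf: "\<And>i. i \<in> I \<Longrightarrow> sigma_finite_measure (density (M i) (f i))"
  shows "density (PiM I M) (\<lambda>x. \<Prod>i\<in>I. f i (x i)) = PiM I (\<lambda>i. density (M i) (f i))"
proof -
  interpret M: product_sigma_finite M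
    using M by (simp add: product_sigma_finite_def)
  \<comment> \<open>\<open>PiM_eqI\<close> wants sigma-finite factors at every index, but \<open>f\<close> is arbitrary outside \<open>I\<close>.\<close>
  define g where "g i = (if i \<in> I then f i else (\<lambda>_. 1))" for i
  interpret D: product_sigma_finite "\<lambda>i. density (M i) (g i)"
    using M sf by (simp add: product_sigma_finite_def g_def density_1)
  have "density (PiM I M) (\<lambda>x. \<Prod>i\<in>I. f i (x i)) = PiM I (\<lambda>i. density (M i) (g i))"
  proof (rule D.PiM_eqI)
    show "sets (density (PiM I M) (\<lambda>x. \<Prod>i\<in>I. f i (x i))) = sets (PiM I (\<lambda>i. density (M i) (g i)))"
      by (simp cong: sets_PiM_cong)
  next
    fix A assume A: "\<And>i. i \<in> I \<Longrightarrow> A i \<in> sets (density (M i) (g i))"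
    then have [measurable]: "A i \<in> sets (M i)" if "i \<in> I" for i
      using that by simp
    have [measurable]: "Pi\<^sub>E I A \<in> sets (PiM I M)"
      using A I by (intro sets_PiM_I_finite) auto
    have "emeasure (density (PiM I M) (\<lambda>x. \<Prod>i\<in>I. f i (x i))) (Pi\<^sub>E I A)
        = (\<integral>\<^sup>+x. (\<Prod>i\<in>I. f i (x i)) * indicator (Pi\<^sub>E I A) x \<partial>PiM I M)"
      by (subst emeasure_density) (auto)
    also have "\<dots> = (\<integral>\<^sup>+x. (\<Prod>i\<in>I. f i (x i) * indicator (A i) (x i)) \<partial>PiM I M)"
    proof (intro nn_integral_cong)
      fix x assume "x \<in> space (PiM I M)"
      \<comment> \<open>Points of the product space are extensional, so lying in the box is a
        condition on the coordinates in \<open>I\<close> alone.\<close>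
      then have "(indicator (Pi\<^sub>E I A) x :: ennreal) = (\<Prod>i\<in>I. indicator (A i) (x i))"
        using I by (auto simp: indicator_def space_PiM PiE_iff)
      then show "(\<Prod>i\<in>I. f i (x i)) * indicator (Pi\<^sub>E I A) x =
          (\<Prod>i\<in>I. f i (x i) * indicator (A i) (x i))"
        by (simp add: prod.distrib)
    qed
    also have "\<dots> = (\<Prod>i\<in>I. \<integral>\<^sup>+x. f i x * indicator (A i) x \<partial>M i)"
      using I by (subst M.product_nn_integral_prod) auto
    also have "\<dots> = (\<Prod>i\<in>I. emeasure (density (M i) (g i)) (A i))"
      by (intro prod.cong) (auto simp: emeasure_density g_def)
    finally show "emeasure (density (PiM I M) (\<lambda>x. \<Prod>i\<in>I. f i (x i))) (Pi\<^sub>E I A)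
        = (\<Prod>i\<in>I. emeasure (density (M i) (g i)) (A i))" .
  qed (fact I)
  also have "\<dots> = PiM I (\<lambda>i. density (M i) (f i))"
    by (intro PiM_cong) (auto simp: g_def)
  finally show ?thesis .
qed

text \<open>Independence makes the joint law the product of the marginal laws, to which
  \<open>density_PiM\<close> applies. This will identify the likelihood as the density of the
  observations.\<close>

lemma (in prob_space) indep_vars_distributed_PiM:
  assumes N: "\<And>i. sigma_finite_measure (N i)" and I: "finite I" "I \<noteq> {}"
    and ind: "indep_vars N X I" and D: "\<And>i. i \<in> I \<Longrightarrow> distributed M (N i) (X i) (f i)"
  shows "distributed M (PiM I N) (\<lambda>\<omega>. \<lambda>i\<in>I. X i \<omega>) (\<lambda>x. \<Prod>i\<in>I. f i (x i))"
proof -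
  have X[measurable]: "X i \<in> measurable M (N i)" if "i \<in> I" for i
    using D[OF that] by (rule distributed_measurable)
  have f[measurable]: "f i \<in> borel_measurable (N i)" if "i \<in> I" for i
    using D[OF that] by (rule distributed_borel_measurable)
  have sf: "sigma_finite_measure (density (N i) (f i))" if "i \<in> I" for i
    using prob_space_distr[OF X[OF that]] distributed_distr_eq_density[OF D[OF that]]
    by (simp add: prob_space_imp_sigma_finite)
  have "distr M (PiM I N) (\<lambda>\<omega>. \<lambda>i\<in>I. X i \<omega>) = PiM I (\<lambda>i. distr M (N i) (X i))"
    using ind I X by (subst indep_vars_iff_distr_eq_PiM'[symmetric]) auto
  also have "\<dots> = PiM I (\<lambda>i. density (N i) (f i))"
    by (intro PiM_cong) (auto simp: distributed_distr_eq_density[OF D])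
  also have "\<dots> = density (PiM I N) (\<lambda>x. \<Prod>i\<in>I. f i (x i))"
    using N I(1) f sf by (rule density_PiM[symmetric])
  finally show ?thesis
    by (simp add: distributed_def measurable_restrict)
qed

text \<open>Lebesgue measure is translation invariant, so adding a known signal to the noise merely
  shifts the density.\<close>

lemma distributed_lborel_add_const:
  fixes X :: "'w \<Rightarrow> 'a::euclidean_space"
  assumes X: "distributed M lborel X f"
  shows "distributed M lborel (\<lambda>\<omega>. c + X \<omega>) (\<lambda>z. f (z - c))"
proof -
  have [measurable]: "X \<in> borel_measurable M" "f \<in> borel_measurable borel"
    using distributed_measurable[OF X] distributed_borel_measurable[OF X] by simp_all
  have "distr M lborel (\<lambda>\<omega>. c + X \<omega>) = distr (distr M lborel X) lborel ((+) c)"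
    by (subst distr_distr) (auto simp: comp_def)
  also have "\<dots> = distr (density lborel f) borel ((+) c)"
    by (intro distr_cong) (simp_all add: distributed_distr_eq_density[OF X])
  also have "\<dots> = density (distr lborel borel ((+) c)) (\<lambda>z. f (z - c))"
    by (subst density_distr) auto
  finally show ?thesis
    by (simp add: distributed_def lborel_distr_plus)
qed

section \<open>The circular complex Gaussian law\<close>

lemma cn_density_pos: "v > 0 \<Longrightarrow> cn_density \<mu> v z > 0"
  by (simp add: cn_density_def)

lemma cn_density_nonneg: "v > 0 \<Longrightarrow> cn_density \<mu> v z \<ge> 0"
  by (simp add: cn_density_def)

lemma borel_measurable_cn_density [measurable]: "cn_density \<mu> v \<in> borel_measurable borel"
  unfolding cn_density_def by measurable

lemma cn_density_shift: "cn_density 0 v (z - \<mu>) = cn_density \<mu> v z"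
  by (simp add: cn_density_def)

text \<open>The squared modulus splits over the two coordinates, and the constants
  \<open>1 / sqrt (pi * v)\<close> of the two factors multiply to
  \<open>1 / (pi * v)\<close>.\<close>

lemma cn_density_eq_normal:
  assumes "v > 0"
  shows "cn_density 0 v z = normal_density 0 (sqrt (v / 2)) (Re z) * normal_density 0 (sqrt (v / 2)) (Im z)"
  using assms
  by (simp add: cn_density_def normal_density_def cmod_power2 real_sqrt_mult[symmetric]
      exp_add[symmetric] add_divide_distrib diff_divide_distrib flip: power2_eq_square)

lemma cn_density_monomial:
  assumes v: "v > 0"
  shows "has_bochner_integral lborel (\<lambda>z. cn_density 0 v z * (Re z ^ j * Im z ^ k))
    ((\<integral>x. normal_density 0 (sqrt (v / 2)) x * x ^ j \<partial>lborel) *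
     (\<integral>x. normal_density 0 (sqrt (v / 2)) x * x ^ k \<partial>lborel))"
proof -
  let ?n = "normal_density 0 (sqrt (v / 2))"
  \<comment> \<open>The basis vector 1 carries the real part, hence the exponent
    \<open>j\<close>.\<close>
  define f where "f b x = ?n x * x ^ (if b = (1::complex) then j else k)" for b and x :: real
  have int: "integrable lborel (f b)" for b
    using integrable_normal_moment[of "sqrt (v / 2)" 0] v by (simp add: f_def[abs_def])
  have ne: "\<i> \<noteq> (1::complex)"
    by (simp add: complex_eq_iff)
  have "(\<lambda>z. cn_density 0 v z * (Re z ^ j * Im z ^ k)) = (\<lambda>z. \<Prod>b\<in>Basis. f b (z \<bullet> b))"
    using ne by (simp add: fun_eq_iff Basis_complex_def f_def cn_density_eq_normal[OF v] ac_simps)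
  moreover have "(\<Prod>b\<in>Basis. \<integral>x. f b x \<partial>lborel) =
      (\<integral>x. ?n x * x ^ j \<partial>lborel) * (\<integral>x. ?n x * x ^ k \<partial>lborel)"
    using ne by (simp add: Basis_complex_def f_def)
  ultimately show ?thesis
    using integrable_lborel_prod[of f] integral_lborel_prod[of f] int
    by (simp add: has_bochner_integral_iff)
qed

lemma cn_density_first_moment:
  assumes v: "v > 0"
  shows "has_bochner_integral lborel (\<lambda>z. cn_density 0 v z * (z \<bullet> a)) 0"
proof -
  have s: "0 < sqrt (v / 2)" using v by simp
  note n = integral_normal_moment_odd[OF s, of 0 0]
  have "has_bochner_integral lborel
    (\<lambda>z. cn_density 0 v z * (Re z ^ 1 * Im z ^ 0) * Re a + cn_density 0 v z * (Re z ^ 0 * Im z ^ 1) * Im a)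
    (0 * Re a + 0 * Im a)"
    using cn_density_monomial[OF v, of 1 0] cn_density_monomial[OF v, of 0 1] n
    by (intro has_bochner_integral_add has_bochner_integral_mult_left) simp_all
  then show ?thesis
    by (simp add: inner_complex_def algebra_simps)
qed

text \<open>Of the three monomials in the expansion, the mixed one has odd moments and vanishes; the
  two squares have equal weight \<open>v / 2\<close>, so a multiple of \<open>a \<bullet> b\<close>
  remains.\<close>

lemma cn_density_second_moment:
  assumes v: "v > 0"
  shows "has_bochner_integral lborel (\<lambda>z. cn_density 0 v z * ((z \<bullet> a) * (z \<bullet> b))) (v / 2 * (a \<bullet> b))"
proof -
  have s: "0 < sqrt (v / 2)" using v by simp
  note n0 = integral_normal_density[OF s, of 0]
  note n1 = integral_normal_moment_odd[OF s, of 0 0]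
  have n2: "(\<integral>x. normal_density 0 (sqrt (v / 2)) x * x\<^sup>2 \<partial>lborel) = v / 2"
    using integral_normal_moment_even[OF s, of 0 1] v by (simp add: fact_numeral)
  have "has_bochner_integral lborel
    (\<lambda>z. cn_density 0 v z * (Re z ^ 2 * Im z ^ 0) * (Re a * Re b)
       + cn_density 0 v z * (Re z ^ 1 * Im z ^ 1) * (Re a * Im b + Im a * Re b)
       + cn_density 0 v z * (Re z ^ 0 * Im z ^ 2) * (Im a * Im b))
    (v / 2 * (Re a * Re b) + 0 * (Re a * Im b + Im a * Re b) + v / 2 * (Im a * Im b))"
    using cn_density_monomial[OF v, of 2 0] cn_density_monomial[OF v, of 1 1]
      cn_density_monomial[OF v, of 0 2] n0 n1 n2
    by (intro has_bochner_integral_add has_bochner_integral_mult_left) simp_all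
  then show ?thesis
    by (simp add: inner_complex_def algebra_simps power2_eq_square)
qed

text \<open>In the double sum over pairs of indices, independence and zero mean kill the terms off
  the diagonal; the diagonal gives second moments.\<close>

lemma (in prob_space) cn_covariance:
  fixes w :: "'k \<Rightarrow> 'a \<Rightarrow> complex"
  assumes v: "v > 0" and K: "finite K" and ind: "indep_vars (\<lambda>_. borel) w K"
    and D: "\<And>k. k \<in> K \<Longrightarrow> distributed M lborel (w k) (\<lambda>z. ennreal (cn_density 0 v z))"
  shows "has_bochner_integral M (\<lambda>\<omega>. (\<Sum>k\<in>K. w k \<omega> \<bullet> a k) * (\<Sum>k\<in>K. w k \<omega> \<bullet> b k))
    (v / 2 * (\<Sum>k\<in>K. a k \<bullet> b k))"
proof -
  have transfer: "has_bochner_integral M (\<lambda>\<omega>. g (w k \<omega>)) c"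
    if "k \<in> K" "g \<in> borel_measurable borel" "has_bochner_integral lborel (\<lambda>z. cn_density 0 v z * g z) c"
    for k c and g :: "complex \<Rightarrow> real"
    using that distributed_integral[OF D, of k g] distributed_integrable[OF D, of k g]
    by (simp add: has_bochner_integral_iff cn_density_nonneg[OF v])
  have first: "has_bochner_integral M (\<lambda>\<omega>. w k \<omega> \<bullet> c) 0" if "k \<in> K" for k c
    using that cn_density_first_moment[OF v] by (intro transfer) auto
  have cross: "has_bochner_integral M (\<lambda>\<omega>. (w k \<omega> \<bullet> a k) * (w l \<omega> \<bullet> b l))
      (if l = k then v / 2 * (a k \<bullet> b k) else 0)" if k: "k \<in> K" and l: "l \<in> K" for k l
  proof (cases "l = k")
    case True
    then show ?thesis
      using transfer[of k "\<lambda>z. (z \<bullet> a k) * (z \<bullet> b k)"] k cn_density_second_moment[OF v] by simp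
  next
    case False
    \<comment> \<open>One family over \<open>{k, l}\<close> holds both linear forms, so independence
      passes to it and the expectation of their product factors.\<close>
    define X where "X i \<omega> = w i \<omega> \<bullet> (if i = k then a k else b l)" for i \<omega>
    have "indep_vars (\<lambda>_. borel) w {k, l}"
      using ind by (rule indep_vars_subset) (use k l in auto)
    then have X: "indep_vars (\<lambda>_. borel) X {k, l}"
      unfolding X_def by (rule indep_vars_compose2) auto
    have "has_bochner_integral M (X i) 0" if "i \<in> {k, l}" for i
      using that k l first unfolding X_def by auto
    then have "has_bochner_integral M (\<lambda>\<omega>. \<Prod>i\<in>{k, l}. X i \<omega>) 0"
      using indep_vars_lebesgue_integral[OF _ X] indep_vars_integrable[OF _ X] False
      by (simp add: has_bochner_integral_iff)
    then show ?thesis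
      using False by (simp add: X_def)
  qed
  have "has_bochner_integral M (\<lambda>\<omega>. \<Sum>k\<in>K. \<Sum>l\<in>K. (w k \<omega> \<bullet> a k) * (w l \<omega> \<bullet> b l))
      (\<Sum>k\<in>K. \<Sum>l\<in>K. if l = k then v / 2 * (a k \<bullet> b k) else 0)"
    by (intro has_bochner_integral_sum cross)
  then show ?thesis
    using K by (simp add: sum_product flip: sum_distrib_left sum_divide_distrib)
qed

section \<open>Log-likelihood and score\<close>

lemma ln_cn_likelihood_has_derivative:
  fixes s :: "'k \<Rightarrow> 'b::real_normed_vector \<Rightarrow> complex"
  assumes v: "v > 0" and s: "\<And>k. k \<in> K \<Longrightarrow> (s k has_derivative s' k) (at \<theta>)"
  shows "((\<lambda>\<theta>. ln (\<Prod>k\<in>K. cn_density (s k \<theta>) v (x k))) has_derivative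
    (\<lambda>h. \<Sum>k\<in>K. (x k - s k \<theta>) \<bullet> ((2 / v) *\<^sub>R s' k h))) (at \<theta>)"
proof -
  \<comment> \<open>For infinite \<open>K\<close> the product is 1 and the sum 0, so both sides are
    0.\<close>
  have "ln (\<Prod>k\<in>K. cn_density (s k \<theta>) v (x k)) =
      (\<Sum>k\<in>K. - ((x k - s k \<theta>) \<bullet> (x k - s k \<theta>)) / v - ln (pi * v))" for \<theta>
  proof (cases "finite K")
    case True
    then show ?thesis
    using v by (subst ln_prod)
      (auto simp: cn_density_pos cn_density_def ln_div power2_norm_eq_inner intro!: sum.cong)
  qed simp
  \<comment> \<open>The minus sign before the square cancels the one before \<open>s k\<close> in
    the residual; the square contributes the factor 2.\<close>
  moreover have "((\<lambda>\<theta>. \<Sum>k\<in>K. - ((x k - s k \<theta>) \<bullet> (x k - s k \<theta>)) / v - ln (pi * v)) has_derivative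
      (\<lambda>h. \<Sum>k\<in>K. (x k - s k \<theta>) \<bullet> ((2 / v) *\<^sub>R s' k h))) (at \<theta>)"
    using v by (intro has_derivative_sum)
      (auto intro!: derivative_eq_intros s simp: inner_commute field_simps)
  ultimately show ?thesis
    by simp
qed

text \<open>\<open>score\<close> uses \<open>deriv\<close>, which is informative only where the
  derivative exists; total differentiability supplies it by the chain rule along the
  \<open>i\<close>-th axis.\<close>

lemma score_eq_derivative:
  assumes "((\<lambda>\<theta>. ln (p \<theta> x)) has_derivative L) (at \<theta>)"
  shows "score p \<theta> x $ i = L (axis i 1)"
proof -
  interpret L: bounded_linear L
    using assms by (rule has_derivative_bounded_linear)
  have "((\<lambda>h. ln (p (\<theta> + h *\<^sub>R axis i 1) x)) has_derivative (\<lambda>h. L (h *\<^sub>R axis i 1))) (at 0)"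
    by (rule has_derivative_compose[of "\<lambda>h. \<theta> + h *\<^sub>R axis i 1" _ 0 UNIV "\<lambda>\<theta>. ln (p \<theta> x)" L, simplified])
       (auto intro!: derivative_eq_intros assms)
  then have "((\<lambda>h. ln (p (\<theta> + h *\<^sub>R axis i 1) x)) has_field_derivative L (axis i 1)) (at 0)"
    by (simp add: has_field_derivative_def L.scaleR mult.commute[of "L (axis i 1)"] mult_commute_abs)
  then show ?thesis
    by (simp add: score_def DERIV_imp_deriv)
qed

section \<open>The OFDM echo\<close>

text \<open>The phase of the echo is linear in the parameter, so this is both the phase at
  \<open>h\<close> and its derivative in direction \<open>h\<close>; axis vectors give the rates
  \<open>c\<^sub>k\<^sub>i\<close>.\<close>

definition phase_rate :: "real \<Rightarrow> real \<Rightarrow> real \<times> real \<Rightarrow> real ^ 2 \<Rightarrow> real" where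
  "phase_rate \<Delta>f Tsym k h = 2 * pi * (snd k * Tsym * h $ 2 - fst k * \<Delta>f * h $ 1)"

lemma ofdm_echo_has_derivative:
  "((\<lambda>\<theta>. ofdm_echo \<alpha> \<Delta>f Tsym \<theta> k) has_derivative
    (\<lambda>h. phase_rate \<Delta>f Tsym k h *\<^sub>R (\<i> * ofdm_echo \<alpha> \<Delta>f Tsym \<theta> k))) (at \<theta>)"
proof -
  have echo: "ofdm_echo \<alpha> \<Delta>f Tsym \<theta> k = \<alpha> * exp (\<i> * of_real (phase_rate \<Delta>f Tsym k \<theta>))" for \<theta>
    by (cases k) (simp add: ofdm_echo_def phase_rate_def algebra_simps flip: exp_add)
  have "bounded_linear (phase_rate \<Delta>f Tsym k)"
    unfolding phase_rate_def
    by (intro bounded_linear_mult_right[THEN bounded_linear_compose] bounded_linear_sub bounded_linear_vec_nth)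
  note phase = bounded_linear_imp_has_derivative[OF this]
  have "((\<lambda>\<theta>. \<i> * of_real (phase_rate \<Delta>f Tsym k \<theta>)) has_derivative
      (\<lambda>h. \<i> * complex_of_real (phase_rate \<Delta>f Tsym k h))) (at \<theta>)"
    by (intro has_derivative_mult_right has_derivative_of_real phase)
  from has_derivative_mult_right[OF has_derivative_compose[OF this
      DERIV_exp[unfolded has_field_derivative_def]], of \<alpha>]
  show ?thesis
    unfolding echo by (simp add: scaleR_conv_of_real mult_ac)
qed

lemma norm_ofdm_echo: "cmod (ofdm_echo \<alpha> \<Delta>f Tsym \<theta> k) = cmod \<alpha>"
  by (simp add: ofdm_echo_def norm_mult split: prod.split)

section \<open>Sums over the centred index grid\<close>

lemma finite_centered_range [simp]: "finite (centered_range N)"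
  by (simp add: centered_range_def)

lemma sum_centered_range: "sum f (centered_range N) = (\<Sum>i<N. f (real i - (real N - 1) / 2))"
  unfolding centered_range_def by (subst sum.reindex) (auto simp: inj_on_def)

lemma card_centered_range [simp]: "card (centered_range N) = N"
  using sum_centered_range[of "\<lambda>_. 1 :: nat" N] by simp

lemma sum_centered_range_id [simp]: "(\<Sum>n\<in>centered_range N. n) = 0"
proof -
  \<comment> \<open>The offset stays a free \<open>c\<close> because \<open>(N - 1) / 2\<close>
    would change along the induction on \<open>N\<close>.\<close>
  have "(\<Sum>i<N. real i - c) = real N * (real N - 1) / 2 - real N * c" for c
    by (induction N) (auto simp: field_simps)
  then show ?thesis
    by (simp add: sum_centered_range)
qed

lemma sum_centered_range_sq: "(\<Sum>n\<in>centered_range N. n\<^sup>2) = real N * ((real N)\<^sup>2 - 1) / 12"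
proof -
  have "(\<Sum>i<N. (real i - c)\<^sup>2) = real N * (real N - 1) * (2 * real N - 1) / 6
      - c * real N * (real N - 1) + real N * c\<^sup>2" for c
    by (induction N) (auto simp: field_simps power2_eq_square)
  from this[of "(real N - 1) / 2"] show ?thesis
    unfolding sum_centered_range by (simp add: field_simps power2_eq_square)
qed

lemma finite_ofdm_grid [simp]: "finite (ofdm_grid N M)"
  by (simp add: ofdm_grid_def)

lemma ofdm_grid_nonempty: "N \<ge> 1 \<Longrightarrow> M \<ge> 1 \<Longrightarrow> ofdm_grid N M \<noteq> {}"
  by (auto simp: ofdm_grid_def centered_range_def lessThan_empty_iff)

text \<open>The cross term is a multiple of \<open>n * m\<close> and sums to 0 by centring; the sums
  of squares produce \<open>beta_rms_sq\<close> and \<open>gamma_rms_sq\<close>.\<close>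

lemma sum_phase_rate:
  "(\<Sum>k\<in>ofdm_grid N M. phase_rate \<Delta>f Tsym k g * phase_rate \<Delta>f Tsym k h) =
    real N * real M * (4 * pi\<^sup>2 * beta_rms_sq N \<Delta>f * (g $ 1 * h $ 1)
      + 4 * pi\<^sup>2 * gamma_rms_sq M Tsym * (g $ 2 * h $ 2))"
proof -
  let ?A = "centered_range N" and ?B = "centered_range M"
  \<comment> \<open>The last term is bracketed so that everything free of \<open>m\<close> factors
    out, leaving the vanishing sum of \<open>m\<close>.\<close>
  have "(\<Sum>k\<in>ofdm_grid N M. phase_rate \<Delta>f Tsym k g * phase_rate \<Delta>f Tsym k h) =
    (\<Sum>n\<in>?A. \<Sum>m\<in>?B. 4 * pi\<^sup>2 * Tsym\<^sup>2 * (g $ 2 * h $ 2) * m\<^sup>2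
       + 4 * pi\<^sup>2 * \<Delta>f\<^sup>2 * (g $ 1 * h $ 1) * n\<^sup>2
       - (4 * pi\<^sup>2 * \<Delta>f * Tsym * (g $ 1 * h $ 2 + g $ 2 * h $ 1) * n) * m)"
    unfolding ofdm_grid_def sum.cartesian_product
    by (intro sum.cong) (auto simp: phase_rate_def algebra_simps power2_eq_square)
  also have "\<dots> = (\<Sum>n\<in>?A. 4 * pi\<^sup>2 * Tsym\<^sup>2 * (g $ 2 * h $ 2) * (\<Sum>m\<in>?B. m\<^sup>2)
       + real M * (4 * pi\<^sup>2 * \<Delta>f\<^sup>2 * (g $ 1 * h $ 1)) * n\<^sup>2)"
    by (simp add: sum.distrib sum_subtractf flip: sum_distrib_left)
  also have "\<dots> = real N * (4 * pi\<^sup>2 * Tsym\<^sup>2 * (g $ 2 * h $ 2) * (\<Sum>m\<in>?B. m\<^sup>2))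
       + real M * (4 * pi\<^sup>2 * \<Delta>f\<^sup>2 * (g $ 1 * h $ 1)) * (\<Sum>n\<in>?A. n\<^sup>2)"
    by (simp add: sum.distrib flip: sum_distrib_left)
  also have "\<dots> = real N * real M * (4 * pi\<^sup>2 * beta_rms_sq N \<Delta>f * (g $ 1 * h $ 1)
      + 4 * pi\<^sup>2 * gamma_rms_sq M Tsym * (g $ 2 * h $ 2))"
    by (simp add: sum_centered_range_sq beta_rms_sq_def gamma_rms_sq_def field_simps)
  finally show ?thesis .
qed

section \<open>Fisher information of the echo model\<close>

theorem theorem1:
  fixes N M :: nat and \<Delta>f Tsym \<sigma>w2 Ps :: real and \<alpha> :: complex
    and P :: "'w measure" and w :: "real \<times> real \<Rightarrow> 'w \<Rightarrow> complex"
    and y :: "real ^ 2 \<Rightarrow> real \<times> real \<Rightarrow> 'w \<Rightarrow> complex"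
  assumes "N \<ge> 1" "M \<ge> 1" "\<Delta>f > 0" "Tsym > 0" "\<sigma>w2 > 0" "Ps > 0" "\<alpha> \<noteq> 0"
    and "prob_space P"
    and noise_indep: "prob_space.indep_vars P (\<lambda>_. borel) w (ofdm_grid N M)"
    and noise_law: "\<And>k. k \<in> ofdm_grid N M \<Longrightarrow>
           distributed P lborel (w k) (\<lambda>z. ennreal (cn_density 0 (\<sigma>w2 / Ps) z))"
    and observations: "\<And>\<theta> k \<omega>. k \<in> ofdm_grid N M \<Longrightarrow>
           y \<theta> k \<omega> = ofdm_echo \<alpha> \<Delta>f Tsym \<theta> k + w k \<omega>"
  defines "\<nu> \<equiv> obs_base N M"
    and "p \<equiv> ofdm_likelihood N M \<alpha> \<Delta>f Tsym (\<sigma>w2 / Ps)"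
  shows "(\<forall>\<theta>. distributed P \<nu> (\<lambda>\<omega>. \<lambda>k\<in>ofdm_grid N M. y \<theta> k \<omega>) (\<lambda>x. ennreal (p \<theta> x)))
    \<and> (\<forall>\<theta>. \<forall>x\<in>space \<nu>. p \<theta> x > 0 \<and> (\<lambda>\<theta>'. ln (p \<theta>' x)) differentiable (at \<theta>))
    \<and> (\<forall>\<theta> i j. integrable (density \<nu> (\<lambda>x. ennreal (p \<theta> x)))
          (\<lambda>x. score p \<theta> x $ i * score p \<theta> x $ j))
    \<and> (\<forall>\<theta>. fisher_information \<nu> p \<theta> =
          (2 * real N * real M * gamma_sc \<alpha> Ps \<sigma>w2) *\<^sub>R
            vector [vector [4 * pi\<^sup>2 * beta_rms_sq N \<Delta>f, 0],
                    vector [0, 4 * pi\<^sup>2 * gamma_rms_sq M Tsym]])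
    \<and> (\<forall>\<theta>. fisher_information \<nu> p \<theta> $ 1 $ 2 = 0 \<and> fisher_information \<nu> p \<theta> $ 2 $ 1 = 0)
    \<and> (\<lambda>N'. beta_rms_sq N' \<Delta>f) \<sim>[at_top] (\<lambda>N'. (real N' * \<Delta>f)\<^sup>2 / 12)
    \<and> (\<lambda>M'. gamma_rms_sq M' Tsym) \<sim>[at_top] (\<lambda>M'. (real M' * Tsym)\<^sup>2 / 12)"
proof -
  interpret prob_space P by fact
  let ?K = "ofdm_grid N M"
  let ?s = "ofdm_echo \<alpha> \<Delta>f Tsym"
  let ?Y = "\<lambda>\<theta> \<omega>. \<lambda>k\<in>?K. y \<theta> k \<omega>"
  define v where "v = \<sigma>w2 / Ps"
  have v: "v > 0"
    using \<open>\<sigma>w2 > 0\<close> \<open>Ps > 0\<close> by (simp add: v_def)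
  have p: "p \<theta> x = (\<Prod>k\<in>?K. cn_density (?s \<theta> k) v (x k))" for \<theta> x
    by (simp add: p_def ofdm_likelihood_def v_def)
  \<comment> \<open>The vector paired with the residual at \<open>k\<close> in component
    \<open>i\<close> of the score; it absorbs the factor \<open>2 / v\<close>.\<close>
  define D where "D \<theta> i k = (2 / v * phase_rate \<Delta>f Tsym k (axis i 1)) *\<^sub>R (\<i> * ?s \<theta> k)"
    for \<theta> and i :: 2 and k
  have pos: "p \<theta> x > 0" for \<theta> x
    unfolding p by (intro prod_pos) (simp add: cn_density_pos[OF v])
  have deriv: "((\<lambda>\<theta>. ln (p \<theta> x)) has_derivative
      (\<lambda>h. \<Sum>k\<in>?K. (x k - ?s \<theta> k) \<bullet> ((2 / v) *\<^sub>R phase_rate \<Delta>f Tsym k h *\<^sub>R (\<i> * ?s \<theta> k)))) (at \<theta>)"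
    for \<theta> x
    unfolding p by (rule ln_cn_likelihood_has_derivative[OF v ofdm_echo_has_derivative])
  have score: "score p \<theta> x $ i = (\<Sum>k\<in>?K. (x k - ?s \<theta> k) \<bullet> D \<theta> i k)" for \<theta> x i
    by (simp add: score_eq_derivative[OF deriv] D_def)
  \<comment> \<open>The observations are the independent noise variables shifted by the
    deterministic echo.\<close>
  have dist: "distributed P \<nu> (?Y \<theta>) (\<lambda>x. ennreal (p \<theta> x))" for \<theta>
  proof -
    have "distributed P lborel (y \<theta> k) (\<lambda>z. ennreal (cn_density (?s \<theta> k) v z))" if "k \<in> ?K" for k
    proof -
      have "y \<theta> k = (\<lambda>\<omega>. ?s \<theta> k + w k \<omega>)"
        using observations[OF that] by (simp add: fun_eq_iff)
      then show ?thesis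
        using distributed_lborel_add_const[OF noise_law[OF that], of "?s \<theta> k"]
        by (simp add: cn_density_shift v_def)
    qed
    moreover have "indep_vars (\<lambda>_. lborel) (y \<theta>) ?K"
    proof -
      have "indep_vars (\<lambda>_. lborel) (\<lambda>k \<omega>. ?s \<theta> k + w k \<omega>) ?K"
        by (rule indep_vars_compose2[OF noise_indep]) auto
      then show ?thesis
        by (rule indep_vars_cong[THEN iffD1, rotated -1]) (auto simp: observations fun_eq_iff)
    qed
    ultimately have "distributed P \<nu> (?Y \<theta>) (\<lambda>x. \<Prod>k\<in>?K. ennreal (cn_density (?s \<theta> k) v (x k)))"
      unfolding \<nu>_def using \<open>N \<ge> 1\<close> \<open>M \<ge> 1\<close>
      by (intro indep_vars_distributed_PiM)
         (auto simp: ofdm_grid_nonempty sigma_finite_lborel)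
    then show ?thesis
      by (simp add: p prod_ennreal cn_density_nonneg[OF v])
  qed
  have [measurable]: "(\<lambda>x. score p \<theta> x $ i) \<in> borel_measurable \<nu>" for \<theta> i
    unfolding score \<nu>_def by measurable
  have [measurable]: "?Y \<theta> \<in> measurable P \<nu>" for \<theta>
    using dist by (rule distributed_measurable)
  have fisher: "has_bochner_integral (density \<nu> (\<lambda>x. ennreal (p \<theta> x)))
      (\<lambda>x. score p \<theta> x $ i * score p \<theta> x $ j) (v / 2 * (\<Sum>k\<in>?K. D \<theta> i k \<bullet> D \<theta> j k))" for \<theta> i j
  proof -
    \<comment> \<open>At the observations the residual is \<open>w k\<close>, so
      \<open>cn_covariance\<close> applies to the score.\<close>
    have "has_bochner_integral P (\<lambda>\<omega>. score p \<theta> (?Y \<theta> \<omega>) $ i * score p \<theta> (?Y \<theta> \<omega>) $ j)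
        (v / 2 * (\<Sum>k\<in>?K. D \<theta> i k \<bullet> D \<theta> j k))"
      using cn_covariance[OF v finite_ofdm_grid noise_indep, of "D \<theta> i" "D \<theta> j"] noise_law
      by (simp add: score observations v_def)
    \<comment> \<open>The density measure is the law of the observations, so its integrals are
      expectations over \<open>P\<close>.\<close>
    then show ?thesis
      by (simp add: has_bochner_integral_iff integrable_distr_eq integral_distr
          flip: distributed_distr_eq_density[OF dist])
  qed
  have cov: "v / 2 * (\<Sum>k\<in>?K. D \<theta> i k \<bullet> D \<theta> j k) =
      2 * real N * real M * gamma_sc \<alpha> Ps \<sigma>w2 *
        (4 * pi\<^sup>2 * beta_rms_sq N \<Delta>f * (axis i 1 $ 1 * axis j 1 $ 1)
          + 4 * pi\<^sup>2 * gamma_rms_sq M Tsym * (axis i 1 $ 2 * axis j 1 $ 2))" for \<theta> i j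
  proof -
    \<comment> \<open>Both vectors are real multiples of the same one, of modulus
      \<open>cmod \<alpha>\<close>, so the result does not depend on
      \<open>\<theta>\<close>.\<close>
    have "D \<theta> i k \<bullet> D \<theta> j k = (2 / v)\<^sup>2 * (cmod \<alpha>)\<^sup>2 *
        (phase_rate \<Delta>f Tsym k (axis i 1) * phase_rate \<Delta>f Tsym k (axis j 1))" for k
      by (simp add: D_def power2_norm_eq_inner[symmetric] norm_mult norm_ofdm_echo power2_eq_square)
    then have "v / 2 * (\<Sum>k\<in>?K. D \<theta> i k \<bullet> D \<theta> j k) = v / 2 * ((2 / v)\<^sup>2 * (cmod \<alpha>)\<^sup>2 *
        (\<Sum>k\<in>?K. phase_rate \<Delta>f Tsym k (axis i 1) * phase_rate \<Delta>f Tsym k (axis j 1)))"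
      by (simp add: sum_distrib_left)
    \<comment> \<open>Here \<open>v / 2 * (2 / v)\<^sup>2 = 2 / v\<close>, and
      \<open>(cmod \<alpha>)\<^sup>2 / v\<close> is \<open>gamma_sc\<close>.\<close>
    also have "\<dots> = 2 * gamma_sc \<alpha> Ps \<sigma>w2 *
        (\<Sum>k\<in>?K. phase_rate \<Delta>f Tsym k (axis i 1) * phase_rate \<Delta>f Tsym k (axis j 1))"
      using \<open>\<sigma>w2 > 0\<close> \<open>Ps > 0\<close>
      by (simp add: v_def gamma_sc_def power2_eq_square field_simps)
    finally show ?thesis
      unfolding sum_phase_rate by (simp only: mult_ac)
  qed
  have J: "fisher_information \<nu> p \<theta> = (2 * real N * real M * gamma_sc \<alpha> Ps \<sigma>w2) *\<^sub>R
      vector [vector [4 * pi\<^sup>2 * beta_rms_sq N \<Delta>f, 0], vector [0, 4 * pi\<^sup>2 * gamma_rms_sq M Tsym]]" for \<theta>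
    by (simp add: fisher_information_def fisher[THEN has_bochner_integral_integral_eq, unfolded cov]
        vec_eq_iff forall_2 axis_def)
  \<comment> \<open>The approximations are read as ratios tending to 1 as the number of subcarriers
    or symbols grows.\<close>
  have "(\<lambda>N'. beta_rms_sq N' \<Delta>f) \<sim>[at_top] (\<lambda>N'. (real N' * \<Delta>f)\<^sup>2 / 12)"
    unfolding beta_rms_sq_def using \<open>\<Delta>f > 0\<close> by real_asymp
  moreover have "(\<lambda>M'. gamma_rms_sq M' Tsym) \<sim>[at_top] (\<lambda>M'. (real M' * Tsym)\<^sup>2 / 12)"
    unfolding gamma_rms_sq_def using \<open>Tsym > 0\<close> by real_asymp
  moreover have "(\<lambda>\<theta>. ln (p \<theta> x)) differentiable (at \<theta>)" for \<theta> x
    using deriv by (rule differentiableI)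
  moreover have "integrable (density \<nu> (\<lambda>x. ennreal (p \<theta> x))) (\<lambda>x. score p \<theta> x $ i * score p \<theta> x $ j)"
    for \<theta> i j
    using fisher by (rule integrable.intros)
  ultimately show ?thesis
    using dist pos J by simp
qed

end
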